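(* The groups $\mathcal C_4\boxdot\mathcal O$, $\mathcal C_4\boxdot_2\mathcal O$ and $\mathcal C_4\boxdot\mathcal I$ are conjugate in $\mathrm U_2(\mathbb H)$ to $G(\mathcal O,\mathcal C_2,\mathbf 1)$, $G(\mathcal O,\mathbf 1,\beta)$ and $G(\mathcal I,\mathcal C_2,\mathbf 1)$, respectively.
   Context: $\mathbb H$ is the real quaternion algebra with units $i,j,k$, and $\mathbb S^3$ is the group of quaternions of norm $1$; $\mathbb C=\mathbb R+\mathbb Ri\subset\mathbb H$, so $\mathrm U_2(\mathbb C)\subset\mathrm U_2(\mathbb H)$, where $\mathrm U_2(\mathbb H)$ is the group of $2\times2$ quaternionic matrices $A$ with $A\overline A^{\top}=I$. For a finite subgroup $K$ of $\mathbb S^3$, $H\trianglelefteq K$ and $\varphi\in\mathrm{Aut}(K/H)$ with $\varphi^2=1$, $G(K,H,\varphi)\subset \mathrm U_2(\mathbb H)$ is the group of order $2|K||H|$ consisting of all matrices $\mathrm{diag}(\xi,\eta)$ with $\xi,\eta\in K$, $\varphi(H\xi)=H\eta$, together with their products with $\begin{pmatrix}0&1\\1&0\end{pmatrix}$. The symbol $\mathbf 1$ denotes the trivial group or the identity automorphism. Let $\varpi=\frac12(-1+i+j+k)$, $\gamma=\frac1{\sqrt2}(1+i)$, $\tau=\frac12(1+\sqrt5)$, $\sigma=\frac12(\tau^{-1}+i+\tau j)$; $\mathcal C_2=\{\pm1\}$, $\mathcal C_4=\langle i\rangle$, $\mathcal T=\langle i,j,\varpi\rangle$ (order 24), $\mathcal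 O=\langle i,j,\varpi,\gamma\rangle$ (order 48), $\mathcal I=\langle i,\sigma\rangle$ (order 120). $\beta$ is the automorphism of $\mathcal O$ with $\beta(\xi)=\xi$ for $\xi\in\mathcal T$ and $\beta(\xi)=-\xi$ for $\xi\in\mathcal O\setminus\mathcal T$. For $\alpha\in\mathbb C$ with $|\alpha|=1$ and $\xi\in\mathbb S^3$, $\theta(\alpha,\xi)\in\mathrm U_2(\mathbb C)$ is the matrix of the $\mathbb C$-linear map $h\mapsto\alpha h\overline\xi$ of $\mathbb H$ (left $\mathbb C$-space with basis $1,j$, row vector convention): if $\xi=a+bj$ with $a,b\in\mathbb C$, it is $\alpha\begin{pmatrix}\overline a&-b\\ \overline b&a\end{pmatrix}$. $\mathcal C_4\circ K$ is $\{\theta(\alpha,\xi):\alpha\in\mathcal C_4,\ \xi\in K\}$ and $\mathcal C_4\circ_2\mathcal O$ is the set of $\theta(i^a,\xi)$ with $\xi\in\mathcal O$ and $a$ even if $\xi\in\mathcal T$, $a$ odd if $\xi\in\mathcal O\setminus\mathcal T$. Let $s=\begin{pmatrix}0&j\\-j&0\end{pmatrix}$, which has order $2$ and normalises these groups. Then $\mathcal C_4\boxdot K=(\mathcal C_4\circ K)\langle s\rangle$ and $\mathcal C_4\boxdot_2\mathcal O=(\mathcal C_4\circ_2\mathcal O)\langle s\rangle$. *)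

theory Defs
  imports "HOL-Analysis.Analysis" "HOL-Algebra.Coset" "HOL-Algebra.Generated_Groups"
begin

section \<open>The real quaternions\<close>

datatype quat = Quat (q0: real) (q1: real) (q2: real) (q3: real)

lemma quat_eqI:
  "q0 x = q0 y \<Longrightarrow> q1 x = q1 y \<Longrightarrow> q2 x = q2 y \<Longrightarrow> q3 x = q3 y \<Longrightarrow> x = y"
  by (rule quat.expand) simp

instantiation quat :: real_vector
begin

definition "0 = Quat 0 0 0 0"
definition "x + y = Quat (q0 x + q0 y) (q1 x + q1 y) (q2 x + q2 y) (q3 x + q3 y)"
definition "x - y = Quat (q0 x - q0 y) (q1 x - q1 y) (q2 x - q2 y) (q3 x - q3 y)"
definition "- x = Quat (- q0 x) (- q1 x) (- q2 x) (- q3 x)"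
definition "r *\<^sub>R x = Quat (r * q0 x) (r * q1 x) (r * q2 x) (r * q3 x)"

instance
  by standard
    (simp_all add: zero_quat_def plus_quat_def minus_quat_def uminus_quat_def scaleR_quat_def
      algebra_simps)

end

instantiation quat :: real_algebra_1
begin

definition "1 = Quat 1 0 0 0"
definition "x * y = Quat
  (q0 x * q0 y - q1 x * q1 y - q2 x * q2 y - q3 x * q3 y)
  (q0 x * q1 y + q1 x * q0 y + q2 x * q3 y - q3 x * q2 y)
  (q0 x * q2 y - q1 x * q3 y + q2 x * q0 y + q3 x * q1 y)
  (q0 x * q3 y + q1 x * q2 y - q2 x * q1 y + q3 x * q0 y)"

instance
  by standard
    (simp_all add: zero_quat_def one_quat_def plus_quat_def scaleR_quat_def times_quat_def
      algebra_simps)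

end

lemmas quat_defs = zero_quat_def one_quat_def plus_quat_def minus_quat_def uminus_quat_def
  scaleR_quat_def times_quat_def

definition qcnj :: "quat \<Rightarrow> quat" where
  "qcnj x = Quat (q0 x) (- q1 x) (- q2 x) (- q3 x)"

text \<open>Every quaternion is uniquely \<open>a + b j\<close> with complex \<open>a\<close>, \<open>b\<close>
  (see \<open>quat_eq_cpart\<close> below).\<close>

definition cpart1 :: "quat \<Rightarrow> complex" where
  "cpart1 x = Complex (q0 x) (q1 x)"

definition cpart2 :: "quat \<Rightarrow> complex" where
  "cpart2 x = Complex (q2 x) (q3 x)"

instantiation quat :: real_normed_div_algebra
begin

definition "norm x = sqrt ((q0 x)\<^sup>2 + (q1 x)\<^sup>2 + (q2 x)\<^sup>2 + (q3 x)\<^sup>2)"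
definition "sgn x = x /\<^sub>R norm x" for x :: quat
definition "dist x y = norm (x - y)" for x y :: quat
definition "uniformity = (INF e\<in>{0<..}. principal {(x, y :: quat). dist x y < e})"
definition "open U \<longleftrightarrow> (\<forall>x\<in>U. eventually (\<lambda>(x', y). x' = x \<longrightarrow> y \<in> U) uniformity)"
  for U :: "quat set"
definition "inverse x = qcnj x /\<^sub>R (norm x)\<^sup>2"
definition "x div y = x * inverse y" for x y :: quat

instance
proof
  fix x y :: quat and r :: real
  have pair: "norm z = norm (cpart1 z, cpart2 z)" for z
    by (simp add: norm_quat_def norm_Pair cmod_def cpart1_def cpart2_def)
  have zero: "norm z = 0 \<longleftrightarrow> z = 0" for z :: quat
    by (cases z) (simp add: pair cpart1_def cpart2_def zero_quat_def zero_prod_def complex_eq_iff)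
  have sq: "(norm z)\<^sup>2 = (q0 z)\<^sup>2 + (q1 z)\<^sup>2 + (q2 z)\<^sup>2 + (q3 z)\<^sup>2" for z
    by (simp add: norm_quat_def)
  show "norm x = 0 \<longleftrightarrow> x = 0" by (rule zero)
  show "norm (x + y) \<le> norm x + norm y"
  proof -
    have "(cpart1 (x + y), cpart2 (x + y)) = (cpart1 x, cpart2 x) + (cpart1 y, cpart2 y)"
      by (simp add: cpart1_def cpart2_def plus_quat_def complex_eq_iff)
    then show ?thesis by (simp only: pair norm_triangle_ineq)
  qed
  show "norm (r *\<^sub>R x) = \<bar>r\<bar> * norm x"
  proof -
    have "(cpart1 (r *\<^sub>R x), cpart2 (r *\<^sub>R x)) = r *\<^sub>R (cpart1 x, cpart2 x)"
      by (simp add: cpart1_def cpart2_def scaleR_quat_def complex_eq_iff)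
    then show ?thesis by (simp only: pair norm_scaleR)
  qed
  show "norm (x * y) = norm x * norm y"
  proof (rule power2_eq_imp_eq)
    show "(norm (x * y))\<^sup>2 = (norm x * norm y)\<^sup>2"
      by (simp add: sq power_mult_distrib) (simp add: times_quat_def power2_eq_square algebra_simps)
  qed (simp_all add: norm_quat_def)
  show "inverse x * x = 1" if "x \<noteq> 0"
  proof -
    have n: "(norm x)\<^sup>2 \<noteq> 0" using that zero by simp
    have "qcnj x * x = (norm x)\<^sup>2 *\<^sub>R 1"
      by (rule quat_eqI)
        (simp_all add: quat_defs qcnj_def sq, simp_all add: power2_eq_square)
    then show ?thesis using n by (simp add: inverse_quat_def)
  qed
  show "x * inverse x = 1" if "x \<noteq> 0"
  proof -
    have n: "(norm x)\<^sup>2 \<noteq> 0" using that zero by simp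
    have "x * qcnj x = (norm x)\<^sup>2 *\<^sub>R 1"
      by (rule quat_eqI)
        (simp_all add: quat_defs qcnj_def sq, simp_all add: power2_eq_square)
    then show ?thesis using n by (simp add: inverse_quat_def)
  qed
  show "inverse (0 :: quat) = 0"
    by (simp add: inverse_quat_def qcnj_def zero_quat_def scaleR_quat_def)
qed (simp_all add: sgn_quat_def dist_quat_def uniformity_quat_def open_quat_def divide_quat_def)

end

definition qi :: quat where "qi = Quat 0 1 0 0"
definition qj :: quat where "qj = Quat 0 0 1 0"
definition qk :: quat where "qk = Quat 0 0 0 1"

definition of_complex :: "complex \<Rightarrow> quat" where
  "of_complex z = Quat (Re z) (Im z) 0 0"

lemma quat_eq_cpart: "x = of_complex (cpart1 x) + of_complex (cpart2 x) * qj"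
  by (rule quat_eqI) (simp_all add: quat_defs of_complex_def cpart1_def cpart2_def qj_def)


section \<open>The unit quaternions and the quaternionic unitary group\<close>

definition S3 :: "quat monoid" where
  "S3 = \<lparr>carrier = {x. norm x = 1}, mult = (*), one = 1\<rparr>"

lemma group_S3: "group S3"
proof (rule groupI)
  fix x assume "x \<in> carrier S3"
  then show "\<exists>y\<in>carrier S3. y \<otimes>\<^bsub>S3\<^esub> x = \<one>\<^bsub>S3\<^esub>"
    by (intro bexI[of _ "inverse x"]) (auto simp: S3_def norm_inverse intro: left_inverse)
qed (auto simp: S3_def norm_mult mult.assoc)

definition cnj_transpose :: "quat^'n^'m \<Rightarrow> quat^'m^'n" where
  "cnj_transpose A = (\<chi> r c. qcnj (A $ c $ r))"

definition U2H :: "(quat^2^2) monoid" where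
  "U2H = \<lparr>carrier = {A. A ** cnj_transpose A = mat 1}, mult = (**), one = mat 1\<rparr>"

definition conjugate_in :: "('a, 'b) monoid_scheme \<Rightarrow> 'a set \<Rightarrow> 'a set \<Rightarrow> bool" where
  "conjugate_in G X Y \<longleftrightarrow> (\<exists>g\<in>carrier G. (g <#\<^bsub>G\<^esub> X) #>\<^bsub>G\<^esub> inv\<^bsub>G\<^esub> g = Y)"

definition mat2 :: "'a \<Rightarrow> 'a \<Rightarrow> 'a \<Rightarrow> 'a \<Rightarrow> ('a::zero)^2^2" where
  "mat2 a b c d = vector [vector [a, b], vector [c, d]]"


section \<open>Finite groups of unit quaternions\<close>

definition varpi :: quat where
  "varpi = (1/2) *\<^sub>R (- 1 + qi + qj + qk)"

definition gamma :: quat where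
  "gamma = (1 / sqrt 2) *\<^sub>R (1 + qi)"

definition tau :: real where
  "tau = (1 + sqrt 5) / 2"

definition sigma :: quat where
  "sigma = (1/2) *\<^sub>R (of_real (inverse tau) + qi + tau *\<^sub>R qj)"

definition C2 :: "quat set" where
  "C2 = {1, - 1}"

definition C4 :: "quat set" where
  "C4 = generate S3 {qi}"

definition bin_tetrahedral :: "quat set" where
  "bin_tetrahedral = generate S3 {qi, qj, varpi}"

definition bin_octahedral :: "quat set" where
  "bin_octahedral = generate S3 {qi, qj, varpi, gamma}"

definition bin_icosahedral :: "quat set" where
  "bin_icosahedral = generate S3 {qi, sigma}"

text \<open>The automorphism \<open>\<beta>\<close> of the binary octahedral group; its values outside that group are
  irrelevant.\<close>

definition beta :: "quat \<Rightarrow> quat" where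
  "beta x = (if x \<in> bin_tetrahedral then x else - x)"


section \<open>The groups \<open>G(K, H, \<phi>)\<close>\<close>

text \<open>Meant for a finite subgroup \<open>K\<close> of \<open>S3\<close>, a normal subgroup \<open>H\<close> of \<open>K\<close> and an automorphism
  \<open>\<phi>\<close> of \<open>K/H\<close> with \<open>\<phi>\<^sup>2 = 1\<close>; thus \<open>\<phi>\<close> acts on cosets. An automorphism \<open>f\<close> of \<open>K\<close> itself
  is passed, for \<open>H = {1}\<close>, as the map \<open>image f\<close> on the singleton cosets.\<close>

definition G_diag :: "quat set \<Rightarrow> quat set \<Rightarrow> (quat set \<Rightarrow> quat set) \<Rightarrow> (quat^2^2) set" where
  "G_diag K H \<phi> =
    {mat2 x 0 0 y |x y. x \<in> K \<and> y \<in> K \<and> \<phi> (H #>\<^bsub>S3\<^esub> x) = H #>\<^bsub>S3\<^esub> y}"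

definition G_imprim :: "quat set \<Rightarrow> quat set \<Rightarrow> (quat set \<Rightarrow> quat set) \<Rightarrow> (quat^2^2) set" where
  "G_imprim K H \<phi> = G_diag K H \<phi> \<union> (\<lambda>A. A ** mat2 0 1 1 0) ` G_diag K H \<phi>"


section \<open>The groups obtained from the maps \<open>h \<mapsto> \<alpha> h \<xi>\<^sup>*\<close> and the reflection \<open>s\<close>\<close>

definition theta :: "complex \<Rightarrow> quat \<Rightarrow> complex^2^2" where
  "theta \<alpha> x = (let a = cpart1 x; b = cpart2 x in
    mat2 (\<alpha> * cnj a) (\<alpha> * - b) (\<alpha> * cnj b) (\<alpha> * a))"

lemma theta_is_matrix_of_map:
  "vector [cpart1 (of_complex \<alpha> * h * qcnj x), cpart2 (of_complex \<alpha> * h * qcnj x)]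
    = (vector [cpart1 h, cpart2 h] :: complex^2) v* theta \<alpha> x"
  by (simp add: vec_eq_iff forall_2 vector_matrix_mult_def sum_2 theta_def mat2_def Let_def
      quat_defs of_complex_def qcnj_def cpart1_def cpart2_def complex_eq_iff algebra_simps)

text \<open>The entrywise inclusion of complex matrices in quaternionic matrices.\<close>

definition of_complex_mat :: "complex^2^2 \<Rightarrow> quat^2^2" where
  "of_complex_mat A = (\<chi> r c. of_complex (A $ r $ c))"

definition C4_circ :: "quat set \<Rightarrow> (quat^2^2) set" where
  "C4_circ K = {of_complex_mat (theta \<alpha> x) |\<alpha> x. of_complex \<alpha> \<in> C4 \<and> x \<in> K}"

definition C4_circ2_O :: "(quat^2^2) set" where
  "C4_circ2_O = {of_complex_mat (theta (\<i> ^ a) x) |a x.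
    x \<in> bin_octahedral \<and> (even a \<longleftrightarrow> x \<in> bin_tetrahedral)}"

definition s_mat :: "quat^2^2" where
  "s_mat = mat2 0 qj (- qj) 0"

definition C4_boxdot :: "quat set \<Rightarrow> (quat^2^2) set" where
  "C4_boxdot K = C4_circ K <#>\<^bsub>U2H\<^esub> generate U2H {s_mat}"

definition C4_boxdot2_O :: "(quat^2^2) set" where
  "C4_boxdot2_O = C4_circ2_O <#>\<^bsub>U2H\<^esub> generate U2H {s_mat}"

end

theory Submission
  imports Defs
begin

text \<open>
  The rows \<open>r\<close> of a suitable unitary matrix \<open>g\<close> satisfy \<open>r \<theta>(1, \<xi>) = \<xi>\<^sup>* r\<close>, so
  conjugation by \<open>g\<close> turns \<open>\<theta>(1, \<xi>)\<close> into \<open>diag(\<xi>\<^sup>*, \<xi>\<^sup>*)\<close>. The rows are moreover chosen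
  such that \<open>s\<close> interchanges them and the scalar \<open>i\<close> becomes the real matrix
  \<open>((0, -1), (1, 0))\<close>. Hence \<open>\<theta>(i, \<xi>) s\<close> becomes \<open>diag(-\<xi>\<^sup>*, \<xi>\<^sup>*)\<close>, and all three conjugacies
  hold with the same \<open>g\<close>.
\<close>

section \<open>Two by two matrices and quaternion conjugation\<close>

lemma mat2_mult:
  "mat2 a b c d ** mat2 a' b' c' d' =
    mat2 (a * a' + b * c') (a * b' + b * d') (c * a' + d * c') (c * b' + d * d')"
  for a :: "'a::semiring_1"
  by (simp add: vec_eq_iff forall_2 matrix_matrix_mult_def sum_2 mat2_def)

lemma mat_1_eq_mat2: "mat 1 = mat2 1 0 0 (1 :: 'a::zero_neq_one)"
  by (simp add: vec_eq_iff forall_2 mat_def mat2_def)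

lemma mat2_eq_iff: "mat2 a b c d = mat2 a' b' c' d' \<longleftrightarrow> a = a' \<and> b = b' \<and> c = c' \<and> d = d'"
  by (auto simp: vec_eq_iff forall_2 mat2_def)

lemma cnj_transpose_mat2: "cnj_transpose (mat2 a b c d) = mat2 (qcnj a) (qcnj c) (qcnj b) (qcnj d)"
  by (simp add: vec_eq_iff forall_2 cnj_transpose_def mat2_def)

lemma of_complex_mat_mat2:
  "of_complex_mat (mat2 a b c d) = mat2 (of_complex a) (of_complex b) (of_complex c) (of_complex d)"
  by (simp add: vec_eq_iff forall_2 of_complex_mat_def mat2_def)

lemma qcnj_qcnj [simp]: "qcnj (qcnj x) = x"
  by (simp add: qcnj_def)

lemma qcnj_mult: "qcnj (x * y) = qcnj y * qcnj x"
  by (rule quat_eqI) (simp_all add: quat_defs qcnj_def)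

lemma qcnj_add: "qcnj (x + y) = qcnj x + qcnj y"
  by (rule quat_eqI) (simp_all add: quat_defs qcnj_def)

lemma qcnj_0 [simp]: "qcnj 0 = 0" and qcnj_1 [simp]: "qcnj 1 = 1"
  by (simp_all add: quat_defs qcnj_def)

lemma qcnj_sum: "qcnj (sum f A) = (\<Sum>i\<in>A. qcnj (f i))"
  by (induction A rule: infinite_finite_induct) (simp_all add: qcnj_add)

text \<open>Transposition alone does not reverse products over a noncommutative ring;
  \<open>qcnj\<close> reverses the factors inside each entry as well, which restores the
  rule.\<close>

lemma cnj_transpose_mult: "cnj_transpose (A ** B) = cnj_transpose B ** cnj_transpose A"
  by (simp add: vec_eq_iff cnj_transpose_def matrix_matrix_mult_def qcnj_sum qcnj_mult)

lemma cnj_transpose_mat_1: "cnj_transpose (mat 1 :: quat^2^2) = mat 1"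
  by (simp add: mat_1_eq_mat2 cnj_transpose_mat2)

section \<open>Products and inverses in \<open>U2H\<close>\<close>

lemma monoid_U2H: "monoid U2H"
proof (rule monoidI)
  fix A B assume "A \<in> carrier U2H" "B \<in> carrier U2H"
  then have A: "A ** cnj_transpose A = mat 1" and B: "B ** cnj_transpose B = mat 1"
    by (simp_all add: U2H_def)
  have "A ** B ** cnj_transpose (A ** B) = A ** (B ** cnj_transpose B) ** cnj_transpose A"
    by (simp add: cnj_transpose_mult matrix_mul_assoc)
  also have "\<dots> = mat 1" by (simp add: A B)
  finally show "A \<otimes>\<^bsub>U2H\<^esub> B \<in> carrier U2H" by (simp add: U2H_def)
qed (simp_all add: U2H_def matrix_mul_assoc cnj_transpose_mat_1)

text \<open>The carrier condition is one-sided; the second identity is what puts the adjoint itself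
  into \<open>U2H\<close>.\<close>

lemma inv_U2H_eq:
  assumes "A ** cnj_transpose A = mat 1" "cnj_transpose A ** A = mat 1"
  shows "inv\<^bsub>U2H\<^esub> A = cnj_transpose A"
proof (rule monoid.inv_unique'[OF monoid_U2H, symmetric])
  have "cnj_transpose (cnj_transpose A) = A" by (simp add: vec_eq_iff cnj_transpose_def)
  then show "cnj_transpose A \<in> carrier U2H" using assms by (simp add: U2H_def)
qed (use assms in \<open>simp_all add: U2H_def\<close>)

lemma generate_involution:
  assumes "monoid G" "s \<in> carrier G" "s \<otimes>\<^bsub>G\<^esub> s = \<one>\<^bsub>G\<^esub>"
  shows "generate G {s} = {\<one>\<^bsub>G\<^esub>, s}"
proof
  interpret monoid G by fact
  have inv: "inv\<^bsub>G\<^esub> s = s" using assms by (intro inv_unique'[symmetric]) auto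
  have "x \<in> {\<one>\<^bsub>G\<^esub>, s}" if "x \<in> generate G {s}" for x
    using that by induction (use assms inv in auto)
  then show "generate G {s} \<subseteq> {\<one>\<^bsub>G\<^esub>, s}" by auto
  show "{\<one>\<^bsub>G\<^esub>, s} \<subseteq> generate G {s}" by (auto intro: generate.intros)
qed

section \<open>The reflection \<open>s_mat\<close> and the conjugating matrix\<close>

lemma cnj_transpose_s_mat: "cnj_transpose s_mat = s_mat"
  by (simp add: s_mat_def cnj_transpose_mat2 mat2_eq_iff qcnj_def qj_def quat_defs)

lemma s_mat_square: "s_mat ** s_mat = mat 1"
  unfolding mat_1_eq_mat2 by (simp add: s_mat_def mat2_mult mat2_eq_iff qj_def quat_defs)

lemma generate_s_mat: "generate U2H {s_mat} = {mat 1, s_mat}"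
  using generate_involution[OF monoid_U2H, of s_mat]
  by (simp add: U2H_def s_mat_square cnj_transpose_s_mat)

text \<open>The row (1, -j) satisfies the required identity for \<open>theta 1 x\<close>, and so
  does (c, -jc) for complex c, because c on the right commutes with the complex entries. The rows
  use c = (1 - i)/2 and c' = -(1 + i)/2. Then c' = -ic settles the action of the scalar i, while c'
  being minus the conjugate of c makes \<open>s_mat\<close> swap the rows. As c and c' have squared
  norm 1/2, the rows have norm 1.\<close>

definition conjugator :: "quat^2^2" where
  "conjugator = mat2 (Quat (1/2) (-1/2) 0 0) (Quat 0 0 (-1/2) (-1/2))
    (Quat (-1/2) (-1/2) 0 0) (Quat 0 0 (1/2) (-1/2))"

lemma conjugator_unitary:
  "conjugator ** cnj_transpose conjugator = mat 1"
  "cnj_transpose conjugator ** conjugator = mat 1"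
  unfolding mat_1_eq_mat2
  by (simp_all add: conjugator_def cnj_transpose_mat2 mat2_mult mat2_eq_iff qcnj_def quat_defs)

abbreviation conj_mat :: "quat^2^2 \<Rightarrow> quat^2^2" where
  "conj_mat A \<equiv> conjugator ** A ** cnj_transpose conjugator"

text \<open>Unitarity trades the adjoint for an intertwining identity with a single product on each
  side, which can be checked entrywise.\<close>

lemma conj_mat_eqI:
  assumes "conjugator ** A = B ** conjugator"
  shows "conj_mat A = B"
  using assms by (simp add: matrix_mul_assoc[symmetric] conjugator_unitary)

lemma conj_mat_theta:
  "conj_mat (of_complex_mat (theta 1 x)) = mat2 (qcnj x) 0 0 (qcnj x)"
  "conj_mat (of_complex_mat (theta \<i> x)) = mat2 0 (- qcnj x) (qcnj x) 0"
  by (rule conj_mat_eqI, simp add: conjugator_def theta_def Let_def of_complex_mat_mat2 mat2_mult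
      mat2_eq_iff, simp add: of_complex_def cpart1_def cpart2_def qcnj_def quat_defs)+

lemma conj_mat_theta_s_mat:
  "conj_mat (of_complex_mat (theta 1 x) ** s_mat) = mat2 0 (qcnj x) (qcnj x) 0"
  "conj_mat (of_complex_mat (theta \<i> x) ** s_mat) = mat2 (- qcnj x) 0 0 (qcnj x)"
  by (rule conj_mat_eqI, simp add: conjugator_def theta_def Let_def of_complex_mat_mat2 mat2_mult
      mat2_eq_iff s_mat_def, simp add: of_complex_def cpart1_def cpart2_def qcnj_def quat_defs qj_def)+

text \<open>\<open>X\<close> and \<open>Y\<close> hold the quaternions paired with the scalars 1 and
  i. After conjugation, \<open>theta 1\<close> on \<open>X\<close> and \<open>theta \<i>\<close> on
  \<open>Y\<close> times \<open>s_mat\<close> give the diagonal matrices, the other two families the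
  antidiagonal ones. Closure under \<open>qcnj\<close> absorbs the conjugates.\<close>

lemma conjugate_in_common_form:
  assumes X: "\<And>x. x \<in> X \<Longrightarrow> qcnj x \<in> X"
    and Y: "\<And>x. x \<in> Y \<Longrightarrow> qcnj x \<in> Y" "\<And>x. x \<in> Y \<Longrightarrow> - x \<in> Y"
    and L: "L = (of_complex_mat \<circ> theta 1) ` X \<union> (of_complex_mat \<circ> theta \<i>) ` Y"
    and G: "G_diag K H \<phi> = (\<lambda>x. mat2 x 0 0 x) ` X \<union> (\<lambda>x. mat2 x 0 0 (- x)) ` Y"
  shows "conjugate_in U2H (L <#>\<^bsub>U2H\<^esub> generate U2H {s_mat}) (G_imprim K H \<phi>)"
proof -
  have X_img: "qcnj ` X = X" using X by (auto simp: image_iff) (metis qcnj_qcnj)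
  have Y_img: "qcnj ` Y = Y" using Y by (auto simp: image_iff) (metis qcnj_qcnj)
  have Y_neg: "uminus ` Y = Y" using Y by (auto simp: image_iff) (metis minus_minus)
  have X_re: "(\<lambda>x. f (qcnj x)) ` X = f ` X" for f :: "quat \<Rightarrow> quat^2^2"
    using X_img by (metis image_image)
  have Y_re: "(\<lambda>x. f (qcnj x)) ` Y = f ` Y" for f :: "quat \<Rightarrow> quat^2^2"
    using Y_img by (metis image_image)
  \<comment> \<open>Substituting -x for x moves the minus sign to the other entry, as in the form of
    \<open>G_diag\<close>.\<close>
  have Y_flip: "(\<lambda>x. mat2 (- x) 0 0 x) ` Y = (\<lambda>x. mat2 x 0 0 (- x)) ` Y"
    "(\<lambda>x. mat2 0 (- x) x 0) ` Y = (\<lambda>x. mat2 0 x (- x) 0) ` Y"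
    using image_image[of "\<lambda>x. mat2 x 0 0 (- x)" uminus Y]
      image_image[of "\<lambda>x. mat2 0 x (- x) 0" uminus Y] by (simp_all add: Y_neg)
  have "L <#>\<^bsub>U2H\<^esub> generate U2H {s_mat} = L \<union> (\<lambda>A. A ** s_mat) ` L"
    unfolding generate_s_mat by (auto simp: set_mult_def U2H_def)
  moreover have "(conjugator <#\<^bsub>U2H\<^esub> Z) #>\<^bsub>U2H\<^esub> inv\<^bsub>U2H\<^esub> conjugator = conj_mat ` Z" for Z
    unfolding inv_U2H_eq[OF conjugator_unitary]
    by (auto simp: l_coset_def r_coset_def U2H_def)
  moreover have "conj_mat ` (L \<union> (\<lambda>A. A ** s_mat) ` L) =
      (\<lambda>x. mat2 x 0 0 x) ` X \<union> (\<lambda>x. mat2 0 (- x) x 0) ` Y \<union>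
      ((\<lambda>x. mat2 0 x x 0) ` X \<union> (\<lambda>x. mat2 (- x) 0 0 x) ` Y)"
    by (simp add: L image_Un image_image conj_mat_theta conj_mat_theta_s_mat
        X_re[of "\<lambda>x. mat2 x 0 0 x"] X_re[of "\<lambda>x. mat2 0 x x 0"]
        Y_re[of "\<lambda>x. mat2 0 (- x) x 0"] Y_re[of "\<lambda>x. mat2 (- x) 0 0 x"])
  moreover have "\<dots> = G_imprim K H \<phi>"
    by (simp add: G_imprim_def G image_Un image_image mat2_mult Y_flip Un_ac)
  ultimately show ?thesis
    unfolding conjugate_in_def
    by (intro bexI[of _ conjugator]) (simp_all add: U2H_def conjugator_unitary)
qed

section \<open>Subgroups of \<open>S3\<close> with i among the generators\<close>

lemma generate_S3_closed:
  assumes "S \<subseteq> carrier S3" "qi \<in> S" "x \<in> generate S3 S"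
  shows "- x \<in> generate S3 S" "qcnj x \<in> generate S3 S"
proof -
  have qi: "qi \<in> generate S3 S" by (rule generate.incl) fact
  \<comment> \<open>Negation is left multiplication by i twice, so it stays inside the
    subgroup.\<close>
  have "qi * qi * x = - x"
    by (rule quat_eqI) (simp_all add: qi_def quat_defs)
  then show "- x \<in> generate S3 S"
    using generate.eng[OF generate.eng[OF qi qi] assms(3)] by (simp add: S3_def)
  have nx: "norm x = 1"
    using group.generate_in_carrier[OF group_S3 assms(1,3)] by (simp add: S3_def)
  then have "x \<noteq> 0" by auto
  have inv: "inv\<^bsub>S3\<^esub> x = inverse x"
    using nx \<open>x \<noteq> 0\<close> by (intro group.inv_equality[OF group_S3])
      (auto simp: S3_def norm_inverse)
  \<comment> \<open>For norm 1 the inverse is the conjugate.\<close>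
  have "inv\<^bsub>S3\<^esub> x \<in> generate S3 S"
    by (rule group.generate_m_inv_closed[OF group_S3 assms(1,3)])
  then show "qcnj x \<in> generate S3 S"
    by (simp add: inv inverse_quat_def nx)
qed

section \<open>The groups built from \<open>C4\<close> and \<open>C2\<close>\<close>

lemma C4_eq: "C4 = {1, qi, - 1, - qi}"
proof
  have inv: "inv\<^bsub>S3\<^esub> qi = - qi"
    by (rule group.inv_equality[OF group_S3])
      (simp_all add: S3_def qi_def quat_defs norm_quat_def)
  have "x \<in> {1, qi, - 1, - qi}" if "x \<in> generate S3 {qi}" for x
  proof (use that in induction)
    case (eng h1 h2)
    have "qi * qi = - 1" by (simp add: qi_def quat_defs)
    with eng show ?case by (auto simp: S3_def)
  qed (auto simp: inv, simp_all add: S3_def)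
  then show "C4 \<subseteq> {1, qi, - 1, - qi}" by (auto simp: C4_def)
  have "{qi} \<subseteq> carrier S3" by (simp add: S3_def qi_def norm_quat_def)
  moreover have "1 \<in> generate S3 {qi}" using generate.one[of S3] by (simp add: S3_def)
  ultimately show "{1, qi, - 1, - qi} \<subseteq> C4"
    by (auto simp: C4_def intro: generate.incl generate_S3_closed)
qed

lemma of_complex_in_C4_iff: "of_complex \<alpha> \<in> C4 \<longleftrightarrow> \<alpha> \<in> {1, \<i>, - 1, - \<i>}"
  by (auto simp: C4_eq of_complex_def qi_def quat_defs complex_eq_iff)

text \<open>Over a set closed under negation this reduces the four scalars of \<open>C4\<close> to 1
  and i.\<close>

lemma theta_minus: "theta (- \<alpha>) x = theta \<alpha> (- x)"
  by (simp add: theta_def Let_def mat2_eq_iff cpart1_def cpart2_def uminus_quat_def complex_eq_iff)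

lemma C4_circ_eq:
  assumes "\<And>x. x \<in> K \<Longrightarrow> - x \<in> K"
  shows "C4_circ K = (of_complex_mat \<circ> theta 1) ` K \<union> (of_complex_mat \<circ> theta \<i>) ` K"
  unfolding C4_circ_def of_complex_in_C4_iff using assms by (auto simp: theta_minus)

lemma G_diag_C2:
  assumes "\<And>x. x \<in> K \<Longrightarrow> - x \<in> K"
  shows "G_diag K C2 id = (\<lambda>x. mat2 x 0 0 x) ` K \<union> (\<lambda>x. mat2 x 0 0 (- x)) ` K"
proof -
  \<comment> \<open>A coset of \<open>C2\<close> is {x, -x}, so it determines its representative up
    to sign.\<close>
  have "C2 #>\<^bsub>S3\<^esub> x = C2 #>\<^bsub>S3\<^esub> y \<longleftrightarrow> y = x \<or> y = - x" for x y
    by (auto simp: r_coset_def S3_def C2_def doubleton_eq_iff)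
  then show ?thesis using assms by (auto simp: G_diag_def mat2_eq_iff)
qed

lemma conjugate_in_C4_boxdot:
  assumes "S \<subseteq> carrier S3" "qi \<in> S"
  shows "conjugate_in U2H (C4_boxdot (generate S3 S)) (G_imprim (generate S3 S) C2 id)"
  unfolding C4_boxdot_def using generate_S3_closed[OF assms]
  by (intro conjugate_in_common_form[where X = "generate S3 S" and Y = "generate S3 S"])
    (auto simp: C4_circ_eq G_diag_C2)

section \<open>Generators of the octahedral and icosahedral groups\<close>

lemma octahedral_generators: "{qi, qj, varpi, gamma} \<subseteq> carrier S3"
  by (auto simp: S3_def qi_def qj_def qk_def varpi_def gamma_def norm_quat_def quat_defs
      power2_eq_square field_simps)

lemma icosahedral_generators: "{qi, sigma} \<subseteq> carrier S3"
proof -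
  have "sqrt 5 > 0" "1 + sqrt 5 \<noteq> 0" by (simp_all add: add_pos_pos less_imp_neq[symmetric])
  \<comment> \<open>The golden ratio satisfies tau^2 = tau + 1, so its inverse is tau - 1.\<close>
  then have "inverse tau = (sqrt 5 - 1) / 2"
    by (simp add: tau_def divide_simps) (simp add: algebra_simps)
  then have sigma: "sigma = Quat ((sqrt 5 - 1) / 4) (1 / 2) ((1 + sqrt 5) / 4) 0"
    unfolding sigma_def by (simp add: of_real_def qi_def qj_def quat_defs tau_def)
  have "(sqrt 5 - 1)\<^sup>2 / 16 + 1 / 4 + (1 + sqrt 5)\<^sup>2 / 16 = 1"
    by (simp add: power2_eq_square field_simps)
  then have "norm sigma = 1"
    by (simp add: sigma norm_quat_def power_divide)
  moreover have "norm qi = 1" by (simp add: qi_def norm_quat_def)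
  ultimately show ?thesis by (simp add: S3_def)
qed

section \<open>The tetrahedral subgroup and the automorphism \<open>beta\<close>\<close>

lemma bin_tetrahedral_subset: "bin_tetrahedral \<subseteq> bin_octahedral"
  unfolding bin_tetrahedral_def bin_octahedral_def
  by (rule group.mono_generate[OF group_S3]) auto

lemma bin_octahedral_closed:
  assumes "x \<in> bin_octahedral"
  shows "- x \<in> bin_octahedral" "qcnj x \<in> bin_octahedral"
  using generate_S3_closed[OF octahedral_generators, of x] assms
  by (simp_all add: bin_octahedral_def)

lemma bin_tetrahedral_closed:
  assumes "x \<in> bin_tetrahedral"
  shows "- x \<in> bin_tetrahedral" "qcnj x \<in> bin_tetrahedral"
  using generate_S3_closed[of "{qi, qj, varpi}" x] octahedral_generators assms
  by (simp_all add: bin_tetrahedral_def)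

text \<open>Negation and conjugation are involutions preserving both groups, so neither can send an
  element of the difference into the smaller group.\<close>

lemma octahedral_diff_closed:
  assumes "x \<in> bin_octahedral - bin_tetrahedral"
  shows "- x \<in> bin_octahedral - bin_tetrahedral" "qcnj x \<in> bin_octahedral - bin_tetrahedral"
  using assms bin_octahedral_closed[of x] bin_tetrahedral_closed[of "- x"]
    bin_tetrahedral_closed[of "qcnj x"] by auto

text \<open>Even powers of i are 1 or -1, odd ones i or -i. The sign is absorbed into x, since the
  tetrahedral group and its complement are both closed under negation.\<close>

lemma C4_circ2_O_eq:
  "C4_circ2_O = (of_complex_mat \<circ> theta 1) ` bin_tetrahedral \<union>
    (of_complex_mat \<circ> theta \<i>) ` (bin_octahedral - bin_tetrahedral)" (is "_ = ?R")
proof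
  show "C4_circ2_O \<subseteq> ?R"
  proof
    fix A assume "A \<in> C4_circ2_O"
    then obtain a x where A: "A = of_complex_mat (theta (\<i> ^ a) x)" and x: "x \<in> bin_octahedral"
      and a: "even a \<longleftrightarrow> x \<in> bin_tetrahedral" by (auto simp: C4_circ2_O_def)
    define b where "b = a div 2"
    show "A \<in> ?R"
    proof (cases "even a")
      case True
      then have "\<i> ^ a = (- 1) ^ b" by (auto simp: b_def elim!: evenE)
      then have "\<i> ^ a = 1 \<or> \<i> ^ a = - 1" by (metis minus_one_power_iff)
      then show ?thesis using A a True bin_tetrahedral_closed(1) by (auto simp: theta_minus)
    next
      case False
      then have "\<i> ^ a = \<i> * (- 1) ^ b" by (auto simp: b_def elim!: oddE)
      then have "\<i> ^ a = \<i> \<or> \<i> ^ a = - \<i>" by (auto simp: minus_one_power_iff)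
      then show ?thesis using A a x False octahedral_diff_closed(1)[of x] by (auto simp: theta_minus)
    qed
  qed
  have "of_complex_mat (theta 1 x) \<in> C4_circ2_O" if "x \<in> bin_tetrahedral" for x
    using that bin_tetrahedral_subset by (force simp: C4_circ2_O_def intro: exI[of _ "0::nat"])
  moreover have "of_complex_mat (theta \<i> x) \<in> C4_circ2_O"
    if "x \<in> bin_octahedral - bin_tetrahedral" for x
    using that by (force simp: C4_circ2_O_def intro: exI[of _ "1::nat"])
  ultimately show "?R \<subseteq> C4_circ2_O" by auto
qed

text \<open>Cosets of the trivial group are singletons, so the diagonal part is the graph of
  \<open>beta\<close>, split along the two cases of its definition.\<close>

lemma G_diag_beta:
  "G_diag bin_octahedral {1} (image beta) = (\<lambda>x. mat2 x 0 0 x) ` bin_tetrahedral \<union>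
    (\<lambda>x. mat2 x 0 0 (- x)) ` (bin_octahedral - bin_tetrahedral)"
proof -
  have "{1} #>\<^bsub>S3\<^esub> x = {x}" for x by (simp add: r_coset_def S3_def)
  moreover have "beta x \<in> bin_octahedral" if "x \<in> bin_octahedral" for x
    using that bin_octahedral_closed(1) by (simp add: beta_def)
  ultimately have "G_diag bin_octahedral {1} (image beta) = (\<lambda>x. mat2 x 0 0 (beta x)) ` bin_octahedral"
    by (auto simp: G_diag_def)
  also have "\<dots> = (\<lambda>x. mat2 x 0 0 (beta x)) ` (bin_tetrahedral \<union> (bin_octahedral - bin_tetrahedral))"
    using bin_tetrahedral_subset by (simp add: Un_absorb1)
  also have "\<dots> = (\<lambda>x. mat2 x 0 0 x) ` bin_tetrahedral \<union>
      (\<lambda>x. mat2 x 0 0 (- x)) ` (bin_octahedral - bin_tetrahedral)"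
    unfolding image_Un by (intro arg_cong2[where f = "(\<union>)"] image_cong) (auto simp: beta_def)
  finally show ?thesis .
qed

theorem theorem7p9:
  shows "conjugate_in U2H (C4_boxdot bin_octahedral) (G_imprim bin_octahedral C2 id)
    \<and> conjugate_in U2H C4_boxdot2_O (G_imprim bin_octahedral {1} (image beta))
    \<and> conjugate_in U2H (C4_boxdot bin_icosahedral) (G_imprim bin_icosahedral C2 id)"
proof (intro conjI)
  show "conjugate_in U2H (C4_boxdot bin_octahedral) (G_imprim bin_octahedral C2 id)"
    unfolding bin_octahedral_def by (rule conjugate_in_C4_boxdot[OF octahedral_generators]) simp
  show "conjugate_in U2H C4_boxdot2_O (G_imprim bin_octahedral {1} (image beta))"
    unfolding C4_boxdot2_O_def
    \<comment> \<open>Unification sets \<open>X\<close> to the tetrahedral group and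
      \<open>Y\<close> to its complement in the octahedral group.\<close>
    by (rule conjugate_in_common_form[OF _ _ _ C4_circ2_O_eq G_diag_beta])
      (use bin_tetrahedral_closed octahedral_diff_closed in blast)+
  show "conjugate_in U2H (C4_boxdot bin_icosahedral) (G_imprim bin_icosahedral C2 id)"
    unfolding bin_icosahedral_def by (rule conjugate_in_C4_boxdot[OF icosahedral_generators]) simp
qed

end
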